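(* For any logic $\mathsf{L}^{\mathsf{A}}$ as in the context, any constant specification $\mathsf{CS}$ and any formula $F\in\mathcal{L}^{\mathsf{A}}_J$: if $\mathsf{L}^{\mathsf{A}}_{\mathsf{CS}}\vdash F$ then $\mathcal{M},\omega\Vdash F$ for all $\mathsf{L}^{\mathsf{A}}_{\mathsf{CS}}$-subset models $\mathcal{M}=(W,W_0,V,E)$ and all $\omega\in W_0$.
   Context: Terms $\mathsf{Tm}^{\mathsf{A}}$: $t::=c_i\mid x_i\mid (t\cdot t)\mid(t+t)\mid\ !t$ ($c_i$ countably many constants, $x_i$ countably many variables). Formulas $\mathcal{L}^{\mathsf{A}}_J$: $F::=p_i\mid\bot\mid F\to F\mid t:F$. Axiom schemes: (cl) all classical propositional axioms; (j) $s:(A\to B)\to(t:A\to s\cdot t:B)$; (j+) $s:A\lor t:A\to(s+t):A$; (j4) $t:A\to\ !t:(t:A)$; (jd) $t:\bot\to\bot$; (jt) $t:A\to A$. A logic $\mathsf{L}^{\mathsf{A}}$ consists of (cl),(j),(j+) and some subset of $\{$(j4),(jd),(jt)$\}$. A constant specification $\mathsf{CS}$ is a set of pairs $(c,A)$, $c$ a constant, $A$ an axiom of $\mathsf{L}^{\mathsf{A}}$. $\mathsf{L}^{\mathsf{A}}_{\mathsf{CS}}$ is the Hilbert system with these axioms, modus ponens and axiom necessitation (for $(c,A)\in\mathsf{CS}$, $n\ge0$ infer $!^nc:\,!^{n-1}c:\cdots:\,!c:c:A$, $!^kc$ being $c$ preceded by $k$ copies of $!$). An $\mathsf{L}^{\mathsf{A}}_{\mathsf{CS}}$-subset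 model is $\mathcal{M}=(W,W_0,V,E)$ with $W$ a set, $\emptyset\ne W_0\subseteq W$, $V:W\times\mathcal{L}^{\mathsf{A}}_J\to\{0,1\}$, $E:W\times\mathsf{Tm}^{\mathsf{A}}\to\mathcal{P}(W)$ such that, with $[A]=\{\upsilon:V(\upsilon,A)=1\}$ and $\mathsf{APP}_\omega(s,t)=\{F:\exists H\,(E(\omega,s)\subseteq[H\to F]$ and $E(\omega,t)\subseteq[H])\}$, for all $\omega\in W_0$, $s,t\in\mathsf{Tm}^{\mathsf{A}}$, $F,G$: $V(\omega,\bot)=0$; $V(\omega,F\to G)=1$ iff $V(\omega,F)=0$ or $V(\omega,G)=1$; $V(\omega,t:F)=1$ iff $E(\omega,t)\subseteq[F]$; $E(\omega,s\cdot t)\subseteq\{\upsilon\in W:\upsilon\in[F]$ for all $F\in\mathsf{APP}_\omega(s,t)\}$; $E(\omega,s+t)\subseteq E(\omega,s)\cap E(\omega,t)$; if (jd)$\in\mathsf{L}^{\mathsf{A}}$ some $\upsilon\in W_0$ is in $E(\omega,t)$; if (jt)$\in\mathsf{L}^{\mathsf{A}}$ then $\omega\in E(\omega,t)$; if (j4)$\in\mathsf{L}^{\mathsf{A}}$ then $E(\omega,!t)\subseteq\{\upsilon:\forall F\,(V(\omega,t:F)=1\Rightarrow V(\upsilon,t:F)=1)\}$; for $(c,A)\in\mathsf{CS}$, $n\ge1$: $E(\omega,c)\subseteq[A]$ and $E(\omega,!^nc)\subseteq[!^{n-1}c:\cdots:\,!c:c:A]$. Truth: $\mathcal{M},\omega\Vdash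 F$ iff $V(\omega,F)=1$. *)

theory Defs
  imports Main
begin

datatype tm =
    Const nat
  | Var nat
  | App tm tm  (infixl "\<^bold>\<cdot>" 75)
  | Plus tm tm  (infixl "\<^bold>+" 70)
  | Bang tm  ("\<^bold>! _" [80] 80)

datatype fm =
    Prop nat
  | Bot  ("\<^bold>\<bottom>")
  | Imp fm fm  (infixr "\<^bold>\<rightarrow>" 57)
  | Just tm fm  (infixr "\<^bold>:" 62)

text \<open>The language has only bottom and implication as primitive classical connectives; disjunction
  is the usual abbreviation.\<close>

abbreviation Neg :: "fm \<Rightarrow> fm"  ("\<^bold>\<not> _" [60] 60)
  where "\<^bold>\<not> A \<equiv> A \<^bold>\<rightarrow> \<^bold>\<bottom>"

abbreviation Disj :: "fm \<Rightarrow> fm \<Rightarrow> fm"  (infixr "\<^bold>\<or>" 58)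
  where "A \<^bold>\<or> B \<equiv> \<^bold>\<not> A \<^bold>\<rightarrow> B"

text \<open>The classical axioms are all formulas of the full language that are instances of
  propositional tautologies: a valuation treats atomic propositions and formulas of the form
  t : F as atoms.\<close>

primrec boolean_eval :: "(fm \<Rightarrow> bool) \<Rightarrow> fm \<Rightarrow> bool" where
  "boolean_eval v (Prop i) \<longleftrightarrow> v (Prop i)"
| "boolean_eval v \<^bold>\<bottom> \<longleftrightarrow> False"
| "boolean_eval v (A \<^bold>\<rightarrow> B) \<longleftrightarrow> (boolean_eval v A \<longrightarrow> boolean_eval v B)"
| "boolean_eval v (t \<^bold>: A) \<longleftrightarrow> v (t \<^bold>: A)"

definition tautology :: "fm \<Rightarrow> bool" where
  "tautology A \<longleftrightarrow> (\<forall>v. boolean_eval v A)"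

text \<open>A logic is given by the set of its optional axiom schemes.\<close>

datatype scheme = J4 | JD | JT

type_synonym logic = "scheme set"

inductive_set axioms_of :: "logic \<Rightarrow> fm set" for L :: logic where
  cl: "tautology A \<Longrightarrow> A \<in> axioms_of L"
| j: "s \<^bold>: (A \<^bold>\<rightarrow> B) \<^bold>\<rightarrow> (t \<^bold>: A \<^bold>\<rightarrow> (s \<^bold>\<cdot> t) \<^bold>: B) \<in> axioms_of L"
| jplus: "(s \<^bold>: A \<^bold>\<or> t \<^bold>: A) \<^bold>\<rightarrow> (s \<^bold>+ t) \<^bold>: A \<in> axioms_of L"
| j4: "J4 \<in> L \<Longrightarrow> t \<^bold>: A \<^bold>\<rightarrow> \<^bold>! t \<^bold>: (t \<^bold>: A) \<in> axioms_of L"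
| jd: "JD \<in> L \<Longrightarrow> t \<^bold>: \<^bold>\<bottom> \<^bold>\<rightarrow> \<^bold>\<bottom> \<in> axioms_of L"
| jt: "JT \<in> L \<Longrightarrow> t \<^bold>: A \<^bold>\<rightarrow> A \<in> axioms_of L"

text \<open>A pair (c, A) has as first component the index of the constant \<open>Const c\<close>.\<close>

definition constant_specification :: "logic \<Rightarrow> (nat \<times> fm) set \<Rightarrow> bool" where
  "constant_specification L CS \<longleftrightarrow> (\<forall>(c, A) \<in> CS. A \<in> axioms_of L)"

primrec bangs :: "nat \<Rightarrow> tm \<Rightarrow> tm" where
  "bangs 0 t = t"
| "bangs (Suc n) t = \<^bold>! (bangs n t)"

text \<open>\<open>necessitated n c A\<close> is the formula !!...!c : ... : !!c : !c : c : A, whose outermost term has n copies of !.\<close>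

primrec necessitated :: "nat \<Rightarrow> nat \<Rightarrow> fm \<Rightarrow> fm" where
  "necessitated 0 c A = Const c \<^bold>: A"
| "necessitated (Suc n) c A = bangs (Suc n) (Const c) \<^bold>: necessitated n c A"

inductive provable :: "logic \<Rightarrow> (nat \<times> fm) set \<Rightarrow> fm \<Rightarrow> bool"
  for L :: logic and CS :: "(nat \<times> fm) set" where
  ax: "A \<in> axioms_of L \<Longrightarrow> provable L CS A"
| mp: "provable L CS A \<Longrightarrow> provable L CS (A \<^bold>\<rightarrow> B) \<Longrightarrow> provable L CS B"
| nec: "(c, A) \<in> CS \<Longrightarrow> provable L CS (necessitated n c A)"

text \<open>Only the values of \<open>val\<close> and \<open>ev\<close> at elements of \<open>worlds\<close> are meaningful.\<close>

record 'w subset_structure =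
  worlds :: "'w set"
  normal_worlds :: "'w set"
  val :: "'w \<Rightarrow> fm \<Rightarrow> bool"
  ev :: "'w \<Rightarrow> tm \<Rightarrow> 'w set"

definition truth_set :: "'w subset_structure \<Rightarrow> fm \<Rightarrow> 'w set" where
  "truth_set M A = {v \<in> worlds M. val M v A}"

definition APP :: "'w subset_structure \<Rightarrow> 'w \<Rightarrow> tm \<Rightarrow> tm \<Rightarrow> fm set" where
  "APP M w s t =
    {F. \<exists>H. ev M w s \<subseteq> truth_set M (H \<^bold>\<rightarrow> F) \<and> ev M w t \<subseteq> truth_set M H}"

definition subset_model ::
  "logic \<Rightarrow> (nat \<times> fm) set \<Rightarrow> 'w subset_structure \<Rightarrow> bool" where
  "subset_model L CS M \<longleftrightarrow>
    normal_worlds M \<noteq> {} \<and> normal_worlds M \<subseteq> worlds M \<and>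
    (\<forall>w \<in> worlds M. \<forall>t. ev M w t \<subseteq> worlds M) \<and>
    (\<forall>w \<in> normal_worlds M.
      \<not> val M w \<^bold>\<bottom> \<and>
      (\<forall>F G. val M w (F \<^bold>\<rightarrow> G) \<longleftrightarrow> \<not> val M w F \<or> val M w G) \<and>
      (\<forall>t F. val M w (t \<^bold>: F) \<longleftrightarrow> ev M w t \<subseteq> truth_set M F) \<and>
      (\<forall>s t. ev M w (s \<^bold>\<cdot> t) \<subseteq> {v \<in> worlds M. \<forall>F \<in> APP M w s t. v \<in> truth_set M F}) \<and>
      (\<forall>s t. ev M w (s \<^bold>+ t) \<subseteq> ev M w s \<inter> ev M w t) \<and>
      (JD \<in> L \<longrightarrow> (\<forall>t. \<exists>v \<in> normal_worlds M. v \<in> ev M w t)) \<and>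
      (JT \<in> L \<longrightarrow> (\<forall>t. w \<in> ev M w t)) \<and>
      (J4 \<in> L \<longrightarrow> (\<forall>t. ev M w (\<^bold>! t) \<subseteq>
        {v \<in> worlds M. \<forall>F. val M w (t \<^bold>: F) \<longrightarrow> val M v (t \<^bold>: F)})) \<and>
      (\<forall>(c, A) \<in> CS.
        ev M w (Const c) \<subseteq> truth_set M A \<and>
        (\<forall>n \<ge> 1. ev M w (bangs n (Const c)) \<subseteq> truth_set M (necessitated (n - 1) c A))))"

definition true_at :: "'w subset_structure \<Rightarrow> 'w \<Rightarrow> fm \<Rightarrow> bool"  where
  "true_at M w F \<longleftrightarrow> val M w F"

end

theory Submission
  imports Defs
begin

lemma subset_modelD:
  assumes "subset_model L CS M" "w \<in> normal_worlds M"
  shows val_Bot: "\<not> val M w \<^bold>\<bottom>"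
    and val_Imp: "val M w (F \<^bold>\<rightarrow> G) \<longleftrightarrow> \<not> val M w F \<or> val M w G"
    and val_Just: "val M w (t \<^bold>: F) \<longleftrightarrow> ev M w t \<subseteq> truth_set M F"
    and ev_App: "ev M w (s \<^bold>\<cdot> t) \<subseteq>
      {v \<in> worlds M. \<forall>F \<in> APP M w s t. v \<in> truth_set M F}"
    and ev_Plus: "ev M w (s \<^bold>+ t) \<subseteq> ev M w s \<inter> ev M w t"
    and ev_JD: "JD \<in> L \<Longrightarrow> \<exists>v \<in> normal_worlds M. v \<in> ev M w t"
    and ev_JT: "JT \<in> L \<Longrightarrow> w \<in> ev M w t"
    and ev_J4: "J4 \<in> L \<Longrightarrow> ev M w (\<^bold>! t) \<subseteq>
      {v \<in> worlds M. \<forall>F. val M w (t \<^bold>: F) \<longrightarrow> val M v (t \<^bold>: F)}"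
    and ev_Const: "(c, A) \<in> CS \<Longrightarrow> ev M w (Const c) \<subseteq> truth_set M A"
    and ev_bangs: "(c, A) \<in> CS \<Longrightarrow> n \<ge> 1 \<Longrightarrow>
      ev M w (bangs n (Const c)) \<subseteq> truth_set M (necessitated (n - 1) c A)"
proof -
  note conditions = assms(1)[unfolded subset_model_def,
      THEN conjunct2, THEN conjunct2, THEN conjunct2, THEN bspec, OF assms(2)]
  note conditions' = conditions[THEN conjunct2]
  show "\<not> val M w \<^bold>\<bottom>" by (rule conditions[THEN conjunct1])
  show "val M w (F \<^bold>\<rightarrow> G) \<longleftrightarrow> \<not> val M w F \<or> val M w G"
    by (rule conditions'[THEN conjunct1, rule_format])
  show "val M w (t \<^bold>: F) \<longleftrightarrow> ev M w t \<subseteq> truth_set M F"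
    by (rule conditions'[THEN conjunct2, THEN conjunct1, rule_format])
  note evs = conditions'[THEN conjunct2, THEN conjunct2]
  show "ev M w (s \<^bold>\<cdot> t) \<subseteq>
      {v \<in> worlds M. \<forall>F \<in> APP M w s t. v \<in> truth_set M F}"
    by (rule evs[THEN conjunct1, THEN spec, THEN spec])
  show "ev M w (s \<^bold>+ t) \<subseteq> ev M w s \<inter> ev M w t"
    by (rule evs[THEN conjunct2, THEN conjunct1, THEN spec, THEN spec])
  note opt = evs[THEN conjunct2, THEN conjunct2]
  show "\<exists>v \<in> normal_worlds M. v \<in> ev M w t" if "JD \<in> L"
    using opt[THEN conjunct1] that by blast
  show "w \<in> ev M w t" if "JT \<in> L"
    using opt[THEN conjunct2, THEN conjunct1] that by blast
  show "ev M w (\<^bold>! t) \<subseteq>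
      {v \<in> worlds M. \<forall>F. val M w (t \<^bold>: F) \<longrightarrow> val M v (t \<^bold>: F)}" if "J4 \<in> L"
    by (rule opt[THEN conjunct2, THEN conjunct2, THEN conjunct1, THEN HOL.mp, OF that, THEN spec])
  note cs = opt[THEN conjunct2, THEN conjunct2, THEN conjunct2]
  show "ev M w (Const c) \<subseteq> truth_set M A" if "(c, A) \<in> CS"
    using bspec[OF cs that] by simp
  show "ev M w (bangs n (Const c)) \<subseteq> truth_set M (necessitated (n - 1) c A)"
    if "(c, A) \<in> CS" "n \<ge> 1"
    using bspec[OF cs that(1)] that(2) by simp
qed

lemma boolean_eval_val:
  assumes "subset_model L CS M" "w \<in> normal_worlds M"
  shows "boolean_eval (val M w) A \<longleftrightarrow> val M w A"
  by (induction A) (auto simp: val_Bot[OF assms] val_Imp[OF assms])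

lemma axiom_sound:
  assumes M: "subset_model L CS M" and w: "w \<in> normal_worlds M"
    and A: "A \<in> axioms_of L"
  shows "val M w A"
proof -
  note semantics = val_Imp[OF M w] val_Just[OF M w] val_Bot[OF M w]
  from A show ?thesis
  proof cases
    case cl
    then show ?thesis
      using boolean_eval_val[OF M w] unfolding tautology_def by blast
  next
    case (j s A B t)
    have "ev M w (s \<^bold>\<cdot> t) \<subseteq> truth_set M B"
      if "ev M w s \<subseteq> truth_set M (A \<^bold>\<rightarrow> B)" "ev M w t \<subseteq> truth_set M A"
    proof -
      \<comment> \<open>The witness for \<open>H\<close> in \<open>APP\<close> is
        \<open>A\<close>.\<close>
      have "B \<in> APP M w s t" using that unfolding APP_def by blast
      then show ?thesis using ev_App[OF M w, of s t] by blast
    qed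
    then show ?thesis unfolding j semantics by blast
  next
    case (jplus s A t)
    \<comment> \<open>Evidence for a sum lies in both evidence sets, so an inclusion for either
      summand suffices.\<close>
    show ?thesis using ev_Plus[OF M w, of s t] unfolding jplus semantics by blast
  next
    case (j4 t A)
    have "ev M w (\<^bold>! t) \<subseteq> truth_set M (t \<^bold>: A)" if "val M w (t \<^bold>: A)"
      using ev_J4[OF M w j4(2), of t] that unfolding truth_set_def by blast
    then show ?thesis using j4(1) val_Imp[OF M w] val_Just[OF M w, of "\<^bold>! t"] by simp
  next
    case (jd t)
    \<comment> \<open>Normality of \<open>v\<close> is essential: bottom may be true at a non-normal
      world.\<close>
    obtain v where "v \<in> normal_worlds M" "v \<in> ev M w t" using ev_JD[OF M w jd(2)] by blast
    then have "\<not> ev M w t \<subseteq> truth_set M \<^bold>\<bottom>"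
      using val_Bot[OF M] unfolding truth_set_def by blast
    then show ?thesis unfolding jd semantics by blast
  next
    case (jt t A)
    \<comment> \<open>The world \<open>w\<close> belongs to its own evidence set, hence to the truth
      set of \<open>A\<close>.\<close>
    have "val M w A" if "ev M w t \<subseteq> truth_set M A"
      using ev_JT[OF M w jt(2), of t] that unfolding truth_set_def by blast
    then show ?thesis unfolding jt semantics by blast
  qed
qed

text \<open>Stripping the outermost term leaves \<open>A\<close> for \<open>n = 0\<close> and
  \<open>necessitated (n - 1) c A\<close> otherwise, exactly the formulas in the two
  \<open>CS\<close> conditions. Hence a case split on \<open>n\<close> replaces induction.\<close>

lemma necessitation_sound:
  assumes M: "subset_model L CS M" and w: "w \<in> normal_worlds M"
    and cA: "(c, A) \<in> CS"
  shows "val M w (necessitated n c A)"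
proof (cases n)
  case 0
  then show ?thesis using ev_Const[OF M w cA] by (simp add: val_Just[OF M w])
next
  case (Suc m)
  then show ?thesis using ev_bangs[OF M w cA, of "Suc m"] by (simp add: val_Just[OF M w])
qed

theorem mainTheorem7:
  fixes L :: logic and CS :: "(nat \<times> fm) set" and F :: fm
  assumes "constant_specification L CS"
    and "provable L CS F"
  shows "\<forall>M :: 'w subset_structure. subset_model L CS M \<longrightarrow>
    (\<forall>w \<in> normal_worlds M. true_at M w F)"
proof (intro allI impI ballI)
  fix M :: "'w subset_structure" and w
  assume M: "subset_model L CS M" and w: "w \<in> normal_worlds M"
  from assms(2) show "true_at M w F"
    unfolding true_at_def
  proof induction
    case (ax A)
    then show ?case by (rule axiom_sound[OF M w])
  next
    case (mp A B)
    then show ?case by (simp add: val_Imp[OF M w])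
  next
    case (nec c A n)
    then show ?case by (rule necessitation_sound[OF M w])
  qed
qed

end
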